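(* Let $\mathcal{H}$ be a hypothesis class on $\mathcal{P}$, let $\varepsilon_0:\mathcal{H}\to[0,\infty]$ be an E-capacity and let $\varepsilon_1:\mathcal{H}\times\mathcal{X}\to[0,\infty]$ be a valid E-capacity kernel. Then $\varepsilon_2(H\mid x):=\varepsilon_0(H)\,\varepsilon_1(H\mid x)$ is an E-capacity kernel that satisfies $$\sup_{P\in H}\mathbb{E}^P[\varepsilon_2(H\mid X)]\le\varepsilon_0(H)\quad\text{for every nonempty }H\in\mathcal{H}.$$
   Context: $(\mathcal{X},\Sigma)$ is a measurable space and $\mathcal{P}$ a collection of probability measures on it; $\mathbb{E}^P$ is expectation when $X\in\mathcal{X}$ has law $P$. A hypothesis class $\mathcal{H}$ is a collection of subsets of $\mathcal{P}$ closed under arbitrary unions (including the empty union, so $\emptyset\in\mathcal{H}$). An E-capacity is a map $\varepsilon:\mathcal{H}\to[0,\infty]$ with $\varepsilon(\emptyset)=\infty$ and $\varepsilon(H')\le\varepsilon(H)$ whenever $H\subseteq H'$, $H,H'\in\mathcal{H}$. An E-capacity kernel is a map $\varepsilon:\mathcal{H}\times\mathcal{X}\to[0,\infty]$, written $\varepsilon(H\mid x)$, with $x\mapsto\varepsilon(H\mid x)$ $\Sigma$-measurable for every $H\in\mathcal{H}$ and $H\mapsto\varepsilon(H\mid x)$ an E-capacity for every $x\in\mathcal{X}$. It is valid if $\mathbb{E}^P[\varepsilon(H\mid X)]\le1$ for every nonempty $H\in\mathcal{H}$ and every $P\in H$. Convention: $0\cdot\infty=\infty\cdot0=0$. *)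

theory Defs
  imports "HOL-Probability.Probability_Measure"
begin

(* A measurable space (X, Sigma) is represented by M :: 'a measure, through space M and
   sets M only; the measure carried by M plays no role.  Since P is carried by the same
   sigma-algebra, space P = space M follows from sets P = sets M. *)
definition prob_measures_on :: "'a measure \<Rightarrow> 'a measure set \<Rightarrow> bool" where
  "prob_measures_on M \<P> \<longleftrightarrow> (\<forall>P\<in>\<P>. prob_space P \<and> sets P = sets M)"

(* Taking \<G> = {} gives {} \<in> \<H>. *)
definition hypothesis_class :: "'a measure set \<Rightarrow> 'a measure set set \<Rightarrow> bool" where
  "hypothesis_class \<P> \<H> \<longleftrightarrow> \<H> \<subseteq> Pow \<P> \<and> (\<forall>\<G>. \<G> \<subseteq> \<H> \<longrightarrow> \<Union>\<G> \<in> \<H>)"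

(* Capacities and kernels are total functions whose values are relevant only for
   H \<in> \<H> (and x \<in> space M). *)
definition e_capacity :: "'a measure set set \<Rightarrow> ('a measure set \<Rightarrow> ennreal) \<Rightarrow> bool" where
  "e_capacity \<H> \<epsilon> \<longleftrightarrow>
     \<epsilon> {} = \<infinity> \<and> (\<forall>H\<in>\<H>. \<forall>H'\<in>\<H>. H \<subseteq> H' \<longrightarrow> \<epsilon> H' \<le> \<epsilon> H)"

definition e_capacity_kernel ::
  "'a measure \<Rightarrow> 'a measure set set \<Rightarrow> ('a measure set \<Rightarrow> 'a \<Rightarrow> ennreal) \<Rightarrow> bool" where
  "e_capacity_kernel M \<H> \<epsilon> \<longleftrightarrow>
     (\<forall>H\<in>\<H>. \<epsilon> H \<in> borel_measurable M) \<and>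
     (\<forall>x\<in>space M. e_capacity \<H> (\<lambda>H. \<epsilon> H x))"

definition valid_e_capacity_kernel ::
  "'a measure \<Rightarrow> 'a measure set set \<Rightarrow> ('a measure set \<Rightarrow> 'a \<Rightarrow> ennreal) \<Rightarrow> bool" where
  "valid_e_capacity_kernel M \<H> \<epsilon> \<longleftrightarrow>
     e_capacity_kernel M \<H> \<epsilon> \<and>
     (\<forall>H\<in>\<H>. H \<noteq> {} \<longrightarrow> (\<forall>P\<in>H. (\<integral>\<^sup>+x. \<epsilon> H x \<partial>P) \<le> 1))"

end

theory Submission
  imports Defs
begin

text \<open>For fixed \<open>H\<close> the factor \<open>\<epsilon>\<^sub>0 H\<close> does not
  depend on the data, so it comes out of the integral under each \<open>P\<close> in
  \<open>H\<close> (\<open>nn_integral_cmult\<close>), and validity bounds the remaining integral by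
  1. This bound is uniform in \<open>P\<close>, hence passes to the supremum. The kernel axioms
  survive the pointwise product because multiplication on \<open>ennreal\<close> is monotone in both
  factors and preserves measurability.\<close>

theorem proposition7:
  fixes M :: "'a measure"
    and \<P> :: "'a measure set"
    and \<H> :: "'a measure set set"
    and \<epsilon>\<^sub>0 :: "'a measure set \<Rightarrow> ennreal"
    and \<epsilon>\<^sub>1 :: "'a measure set \<Rightarrow> 'a \<Rightarrow> ennreal"
  assumes "prob_measures_on M \<P>"
    and "hypothesis_class \<P> \<H>"
    and "e_capacity \<H> \<epsilon>\<^sub>0"
    and "valid_e_capacity_kernel M \<H> \<epsilon>\<^sub>1"
  shows "e_capacity_kernel M \<H> (\<lambda>H x. \<epsilon>\<^sub>0 H * \<epsilon>\<^sub>1 H x) \<and>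
    (\<forall>H\<in>\<H>. H \<noteq> {} \<longrightarrow> (SUP P\<in>H. \<integral>\<^sup>+x. \<epsilon>\<^sub>0 H * \<epsilon>\<^sub>1 H x \<partial>P) \<le> \<epsilon>\<^sub>0 H)"
proof (intro conjI ballI impI)
  have kernel: "e_capacity_kernel M \<H> \<epsilon>\<^sub>1"
    and valid: "\<And>H P. H \<in> \<H> \<Longrightarrow> P \<in> H \<Longrightarrow> (\<integral>\<^sup>+x. \<epsilon>\<^sub>1 H x \<partial>P) \<le> 1"
    using assms(4) by (auto simp: valid_e_capacity_kernel_def)
  have meas: "\<epsilon>\<^sub>1 H \<in> borel_measurable M" if "H \<in> \<H>" for H
    using kernel that by (simp add: e_capacity_kernel_def)
  have "e_capacity \<H> (\<lambda>H. \<epsilon>\<^sub>0 H * \<epsilon>\<^sub>1 H x)" if "x \<in> space M" for x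
  proof -
    have "e_capacity \<H> (\<lambda>H. \<epsilon>\<^sub>1 H x)"
      using kernel that by (simp add: e_capacity_kernel_def)
    \<comment> \<open>At \<open>{}\<close> both factors are infinite, so the product is infinite and
      the convention 0 * infinity = 0 does not interfere.\<close>
    with assms(3) show ?thesis
      by (auto simp: e_capacity_def ennreal_top_mult intro!: mult_mono)
  qed
  then show "e_capacity_kernel M \<H> (\<lambda>H x. \<epsilon>\<^sub>0 H * \<epsilon>\<^sub>1 H x)"
    using meas by (auto simp: e_capacity_kernel_def intro!: borel_measurable_times)
  fix H assume H: "H \<in> \<H>"
  show "(SUP P\<in>H. \<integral>\<^sup>+x. \<epsilon>\<^sub>0 H * \<epsilon>\<^sub>1 H x \<partial>P) \<le> \<epsilon>\<^sub>0 H"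
  proof (rule SUP_least)
    fix P assume P: "P \<in> H"
    \<comment> \<open>Members of \<open>\<H>\<close> are subsets of \<open>\<P>\<close>, so
      \<open>P\<close> lives on the sigma-algebra of \<open>M\<close>; this carries measurability
      over to \<open>P\<close>, as pulling out the constant requires.\<close>
    have "sets P = sets M"
      using assms(1,2) H P by (auto simp: prob_measures_on_def hypothesis_class_def)
    then have "\<epsilon>\<^sub>1 H \<in> borel_measurable P"
      using meas[OF H] measurable_cong_sets by blast
    \<comment> \<open>The constant may be 0 or infinite: with 0 * infinity = 0 the identity holds
      for every value in \<open>ennreal\<close>.\<close>
    then have "(\<integral>\<^sup>+x. \<epsilon>\<^sub>0 H * \<epsilon>\<^sub>1 H x \<partial>P) = \<epsilon>\<^sub>0 H * (\<integral>\<^sup>+x. \<epsilon>\<^sub>1 H x \<partial>P)"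
      by (rule nn_integral_cmult)
    also have "\<dots> \<le> \<epsilon>\<^sub>0 H"
      using mult_left_mono[OF valid[OF H P], of "\<epsilon>\<^sub>0 H"] by simp
    finally show "(\<integral>\<^sup>+x. \<epsilon>\<^sub>0 H * \<epsilon>\<^sub>1 H x \<partial>P) \<le> \<epsilon>\<^sub>0 H" .
  qed
qed

end
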